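(* Consider the multi-dimensional online multiple knapsack problem with departures (defined in the context), and assume $\epsilon_{km}\le\frac{C_{km}\ln2}{\gamma_k}$ for all $k\in K$, $m\in M_k$, where $\gamma_k=2\ln(4\bar\rho_k\bar d_k\xi_k^{\max}+2)$. Then Algorithm 3 outputs a feasible (integral) solution and has a competitive ratio of $O\big(\log(\bar\rho^{\max}\cdot\xi^{\max}\cdot\bar d^{\max})\big)$, where $\bar\rho^{\max}=\max_k\bar\rho_k$, $\xi^{\max}=\max_k\xi_k^{\max}$, $\bar d^{\max}=\max_k\bar d_k$.
   Context: Problem. Finite set $K$ of resources; resource $k$ has a finite set of dimensions $M_k$ with capacities $C_{km}>0$. Discrete time horizon $T$; requests $n\in N$ arrive one at a time. For each $n$, $k$, $m\in M_k$: demand $w_{nkm}\ge0$ (with $w_{nkm}>0$ for at least one $m$), a time interval $T_{nkm}\subseteq T$ of consecutive slots of length $d_{nkm}$; and a reward $v_{nk}\ge0$. On arrival of $n$ all its data are revealed and the algorithm irrevocably rejects $n$ or assigns it to one resource $k$, in which case it consumes $w_{nkm}$ of dimension $m$ during every slot of $T_{nkm}$, for every $m\in M_k$, and reward $v_{nk}$ is obtained. A solution $x\in\{0,1\}^{N\times K}$ is feasible if $\sum_kx_{nk}\le1$ for all $n$ and $\sum_{n:\,t\in T_{nkm}}w_{nkm}x_{nk}\le C_{km}$ for all $k$, $m\in M_k$, $t\in T$; its value is $\sum_{n,k}v_{nk}x_{nk}$. Notation: value density $\rho_{nk}=\frac{v_{nk}}{\sum_{m\in M_k}w_{nkm}d_{nkm}}$;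 demand total fluctuation $\xi_{nk}=\frac{\sum_{m\in M_k}w_{nkm}}{\min_{m\in M_k:w_{nkm}\ne0}w_{nkm}}$, $\xi_k^{\max}=\max_n\xi_{nk}$; $d_k^{\max}=\max_{n,m}d_{nkm}$, $d_k^{\min}=\min_{n,m:d_{nkm}>0}d_{nkm}$, $\bar d_k=d_k^{\max}/d_k^{\min}$. Assumptions: (A1) $\rho_{nk}\in[\rho_k^{\min},\rho_k^{\max}]$ whenever $v_{nk}>0$, with $0<\rho_k^{\min}\le\rho_k^{\max}<\infty$; $\rho_k^{\min}$, $\bar\rho_k=\rho_k^{\max}/\rho_k^{\min}$ and $\xi_k^{\max}$ are known to the algorithm; (A2) $\bar d_k$ is finite and known; (A3) $w_{nkm}\le\epsilon_{km}\le C_{km}$ for all $n$. Parameters: $\gamma_k=2\ln(4\bar\rho_k\bar d_k\xi_k^{\max}+2)$, $\mu_{nkm}=e^{w_{nkm}\gamma_k/C_{km}}$, $\beta_{nkm}=\rho_k^{\min}(\mu_{nkm}-1)$. Algorithm 3: initialize $x=0$, $p_{kmt}=0$, $u_n=0$. When $n$ arrives, let $k^*\in\arg\max_k\{v_{nk}-\sum_{m\in M_k,t\in T_{nkm}}w_{nkm}p_{kmt}\}$. If $v_{nk^*}>\sum_{m\in M_{k^*},t\in T_{nk^*m}}w_{nk^*m}p_{k^*mt}$, set $x_{nk^*}=1$, $u_n=v_{nk^*}-\sum_{m\in M_{k^*},t\in T_{nk^*m}}w_{nk^*m}p_{k^*mt}$, and for every $m\in M_{k^*}$ and $t\in T_{nk^*m}$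 set $p_{k^*mt}\leftarrow\mu_{nk^*m}p_{k^*mt}+\beta_{nk^*m}$; otherwise change nothing. Competitive ratio $\alpha$: for every instance satisfying the assumptions, the optimal offline value is at most $\alpha$ times the value of the algorithm's solution. *)

theory Defs
  imports Complex_Main "HOL-Library.Landau_Symbols"
begin

text \<open>
  Resources, dimensions and time slots are labelled by natural numbers. Requests are numbered
  \<open>0, 1, \<dots>\<close> in order of arrival. The field \<open>slots I n k m\<close> is the set $T_{nkm}$; its length
  $d_{nkm}$ is its cardinality. The density bounds and \<open>eps\<close> are given bounds, not necessarily
  attained.
\<close>

record knapsack =
  resources :: "nat set"
  dims :: "nat \<Rightarrow> nat set"
  cap :: "nat \<Rightarrow> nat \<Rightarrow> real"
  horizon :: nat
  num_requests :: nat
  demand :: "nat \<Rightarrow> nat \<Rightarrow> nat \<Rightarrow> real"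
  slots :: "nat \<Rightarrow> nat \<Rightarrow> nat \<Rightarrow> nat set"
  reward :: "nat \<Rightarrow> nat \<Rightarrow> real"
  rho_min :: "nat \<Rightarrow> real"
  rho_max :: "nat \<Rightarrow> real"
  eps :: "nat \<Rightarrow> nat \<Rightarrow> real"

definition requests :: "knapsack \<Rightarrow> nat set" where
  "requests I = {..<num_requests I}"

definition times :: "knapsack \<Rightarrow> nat set" where
  "times I = {1..horizon I}"

definition dur :: "knapsack \<Rightarrow> nat \<Rightarrow> nat \<Rightarrow> nat \<Rightarrow> nat" where
  "dur I n k m = card (slots I n k m)"

definition well_formed :: "knapsack \<Rightarrow> bool" where
  "well_formed I \<longleftrightarrow>
     finite (resources I) \<and> resources I \<noteq> {} \<and>
     (\<forall>k\<in>resources I. finite (dims I k) \<and> (\<forall>m\<in>dims I k. cap I k m > 0)) \<and>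
     (\<forall>n\<in>requests I. \<forall>k\<in>resources I.
        reward I n k \<ge> 0 \<and>
        (\<forall>m\<in>dims I k. demand I n k m \<ge> 0) \<and>
        (\<exists>m\<in>dims I k. demand I n k m > 0) \<and>
        (\<forall>m\<in>dims I k. slots I n k m \<subseteq> times I \<and> (\<exists>a b. slots I n k m = {a..<b})))"

definition feasible :: "knapsack \<Rightarrow> (nat \<Rightarrow> nat \<Rightarrow> real) \<Rightarrow> bool" where
  "feasible I x \<longleftrightarrow>
     (\<forall>n\<in>requests I. \<forall>k\<in>resources I. x n k \<in> {0, 1}) \<and>
     (\<forall>n\<in>requests I. (\<Sum>k\<in>resources I. x n k) \<le> 1) \<and>
     (\<forall>k\<in>resources I. \<forall>m\<in>dims I k. \<forall>t\<in>times I.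
        (\<Sum>n | n \<in> requests I \<and> t \<in> slots I n k m. demand I n k m * x n k) \<le> cap I k m)"

definition total_value :: "knapsack \<Rightarrow> (nat \<Rightarrow> nat \<Rightarrow> real) \<Rightarrow> real" where
  "total_value I x = (\<Sum>n\<in>requests I. \<Sum>k\<in>resources I. reward I n k * x n k)"

definition offline_opt :: "knapsack \<Rightarrow> real" where
  "offline_opt I = (SUP x\<in>{x. feasible I x}. total_value I x)"

definition density :: "knapsack \<Rightarrow> nat \<Rightarrow> nat \<Rightarrow> real" where
  "density I n k = reward I n k / (\<Sum>m\<in>dims I k. demand I n k m * real (dur I n k m))"

definition xi :: "knapsack \<Rightarrow> nat \<Rightarrow> nat \<Rightarrow> real" where
  "xi I n k = (\<Sum>m\<in>dims I k. demand I n k m)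
     / Min {demand I n k m | m. m \<in> dims I k \<and> demand I n k m \<noteq> 0}"

definition xi_max :: "knapsack \<Rightarrow> nat \<Rightarrow> real" where
  "xi_max I k = Max {xi I n k | n. n \<in> requests I}"

definition d_max :: "knapsack \<Rightarrow> nat \<Rightarrow> nat" where
  "d_max I k = Max {dur I n k m | n m. n \<in> requests I \<and> m \<in> dims I k}"

definition d_min :: "knapsack \<Rightarrow> nat \<Rightarrow> nat" where
  "d_min I k = Min {dur I n k m | n m. n \<in> requests I \<and> m \<in> dims I k \<and> dur I n k m > 0}"

text \<open>
  If all durations on \<open>k\<close> vanish, the numerator is \<open>0\<close> and so is the quotient, whatever the
  minimum of the empty set is.
\<close>

definition d_bar :: "knapsack \<Rightarrow> nat \<Rightarrow> real" where
  "d_bar I k = real (d_max I k) / real (d_min I k)"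

definition rho_bar :: "knapsack \<Rightarrow> nat \<Rightarrow> real" where
  "rho_bar I k = rho_max I k / rho_min I k"

text \<open>
  A positive reward over a zero denominator has density \<open>0\<close> by the convention for division, hence
  violates the lower bound here, just as an infinite density would violate the upper bound.
\<close>

definition density_bounded :: "knapsack \<Rightarrow> bool" where
  "density_bounded I \<longleftrightarrow>
     (\<forall>k\<in>resources I. 0 < rho_min I k \<and> rho_min I k \<le> rho_max I k \<and>
        (\<forall>n\<in>requests I. reward I n k > 0 \<longrightarrow> density I n k \<in> {rho_min I k..rho_max I k}))"

definition demand_bounded :: "knapsack \<Rightarrow> bool" where
  "demand_bounded I \<longleftrightarrow>
     (\<forall>k\<in>resources I. \<forall>m\<in>dims I k.
        eps I k m \<le> cap I k m \<and> (\<forall>n\<in>requests I. demand I n k m \<le> eps I k m))"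

definition gamma :: "knapsack \<Rightarrow> nat \<Rightarrow> real" where
  "gamma I k = 2 * ln (4 * rho_bar I k * d_bar I k * xi_max I k + 2)"

definition mu :: "knapsack \<Rightarrow> nat \<Rightarrow> nat \<Rightarrow> nat \<Rightarrow> real" where
  "mu I n k m = exp (demand I n k m * gamma I k / cap I k m)"

definition beta :: "knapsack \<Rightarrow> nat \<Rightarrow> nat \<Rightarrow> nat \<Rightarrow> real" where
  "beta I n k m = rho_min I k * (mu I n k m - 1)"

record alg_state =
  sol :: "nat \<Rightarrow> nat \<Rightarrow> real"
  price :: "nat \<Rightarrow> nat \<Rightarrow> nat \<Rightarrow> real"
  util :: "nat \<Rightarrow> real"

definition cost :: "knapsack \<Rightarrow> alg_state \<Rightarrow> nat \<Rightarrow> nat \<Rightarrow> real" where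
  "cost I s n k = (\<Sum>m\<in>dims I k. \<Sum>t\<in>slots I n k m. demand I n k m * price s k m t)"

definition init_state :: alg_state where
  "init_state = \<lparr>sol = (\<lambda>n k. 0), price = (\<lambda>k m t. 0), util = (\<lambda>n. 0)\<rparr>"

definition assign :: "knapsack \<Rightarrow> nat \<Rightarrow> nat \<Rightarrow> alg_state \<Rightarrow> alg_state" where
  "assign I n k s =
     \<lparr>sol = (\<lambda>n' k'. if n' = n \<and> k' = k then 1 else sol s n' k'),
      price = (\<lambda>k' m t. if k' = k \<and> m \<in> dims I k \<and> t \<in> slots I n k m
                        then mu I n k m * price s k m t + beta I n k m
                        else price s k' m t),
      util = (util s)(n := reward I n k - cost I s n k)\<rparr>"

text \<open>
  \<open>alg_run I n s\<close>: the algorithm can be in state \<open>s\<close> after processing the first \<open>n\<close> requests.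
  It is a relation because ties in the choice of the maximizing resource are broken arbitrarily.
\<close>

inductive alg_run :: "knapsack \<Rightarrow> nat \<Rightarrow> alg_state \<Rightarrow> bool" for I where
  init: "alg_run I 0 init_state"
| accept: "\<lbrakk>alg_run I n s; n \<in> requests I;
     is_arg_max (\<lambda>k. reward I n k - cost I s n k) (\<lambda>k. k \<in> resources I) k;
     reward I n k > cost I s n k\<rbrakk>
   \<Longrightarrow> alg_run I (Suc n) (assign I n k s)"
| reject: "\<lbrakk>alg_run I n s; n \<in> requests I;
     is_arg_max (\<lambda>k. reward I n k - cost I s n k) (\<lambda>k. k \<in> resources I) k;
     \<not> reward I n k > cost I s n k\<rbrakk>
   \<Longrightarrow> alg_run I (Suc n) s"

definition alg_output :: "knapsack \<Rightarrow> (nat \<Rightarrow> nat \<Rightarrow> real) \<Rightarrow> bool" where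
  "alg_output I x \<longleftrightarrow> (\<exists>s. alg_run I (num_requests I) s \<and> x = sol s)"

definition admissible :: "knapsack \<Rightarrow> bool" where
  "admissible I \<longleftrightarrow> well_formed I \<and> density_bounded I \<and> demand_bounded I \<and>
     (\<forall>k\<in>resources I. \<forall>m\<in>dims I k. eps I k m \<le> cap I k m * ln 2 / gamma I k)"

end

theory Submission
  imports Defs "HOL-Real_Asymp.Real_Asymp"
begin

text \<open>
  Primal-dual argument. The price of a slot with load $L$ is
  $\rho^{\min}(e^{\gamma L/C}-1)$. Every request whose interval contains slot $t$ occupies
  either the $\lceil d^{\min}/2\rceil$ slots ending at $t$ or those starting at $t$. Requests that
  all occupy one such half window together load it up to at most $C/2$: beyond
  $C/2 - C\ln 2/\gamma$ the half window alone costs more than the largest possible reward, and a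
  single demand is at most $C\ln 2/\gamma$. The two half windows add up to $C$, hence feasibility.

  Prices never decrease, so the final prices and utilities are dual feasible and bound the offline
  optimum. Accepting a request on resource $k$ raises the dual objective by at most
  $1 + 4\gamma_k$ times its reward.
\<close>

section \<open>Loads and the dual objective\<close>

text \<open>Only requests whose interval contains all of \<open>S\<close> count. For
  \<open>S = {t}\<close> this is the load on slot \<open>t\<close>; for a half window it is the load
  from the requests that occupy the whole half window.\<close>

definition usage :: "knapsack \<Rightarrow> (nat \<Rightarrow> nat \<Rightarrow> real) \<Rightarrow> nat \<Rightarrow> nat \<Rightarrow> nat set \<Rightarrow> real" where
  "usage I x k m S = (\<Sum>n | n \<in> requests I \<and> S \<subseteq> slots I n k m. demand I n k m * x n k)"

text \<open>The dual objective of the linear relaxation: \<open>util\<close> is the multiplier of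
  the one-resource constraint, \<open>price\<close> that of the capacity constraint.\<close>

definition dual_value :: "knapsack \<Rightarrow> alg_state \<Rightarrow> real" where
  "dual_value I s = (\<Sum>n\<in>requests I. util s n)
     + (\<Sum>k\<in>resources I. \<Sum>m\<in>dims I k. \<Sum>t\<in>times I. cap I k m * price s k m t)"

lemma finite_requests [simp]: "finite (requests I)"
  by (simp add: requests_def)

lemma finite_times [simp]: "finite (times I)"
  by (simp add: times_def)

section \<open>An exponential estimate and a fact on intervals\<close>

text \<open>Follows from \<open>exp y \<le> 1 + y + y\<^sup>2\<close> on the unit interval, which
  contains \<open>ln 2\<close>. It turns the multiplicative price update into an increase linear in
  the demand.\<close>

lemma exp_minus_one_le_two_mult:
  fixes y :: real
  assumes "0 \<le> y" "y \<le> ln 2"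
  shows "exp y - 1 \<le> 2 * y"
proof -
  have "ln (2::real) \<le> 1"
    using ln_le_minus_one[of "2::real"] by simp
  then have "exp y \<le> 1 + y + y\<^sup>2"
    using assms by (intro exp_bound) auto
  moreover have "y\<^sup>2 \<le> y"
    using assms \<open>ln 2 \<le> 1\<close> by (simp add: power2_eq_square mult_left_le)
  ultimately show ?thesis by simp
qed

text \<open>If the interval ends too early to contain the right window, then, having at least
  \<open>2 * h - 1\<close> slots, it starts early enough for the left one. The guard
  \<open>h \<le> t + 1\<close> keeps truncated subtraction from shortening the left window.\<close>

lemma interval_half_window:
  fixes a b t h d :: nat
  assumes "t \<in> {a..<b}" "d \<le> card {a..<b}" "h = (d + 1) div 2" "d > 0"
  shows "(h \<le> t + 1 \<and> {t + 1 - h..t} \<subseteq> {a..<b}) \<or> {t..<t + h} \<subseteq> {a..<b}"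
proof (cases "t + h \<le> b")
  case True
  then show ?thesis using assms by auto
next
  case False
  have "a + d \<le> b" "2 * h \<le> d + 1" using assms by auto
  then have "a + h \<le> t + 1" using False by linarith
  then show ?thesis using assms by auto
qed

section \<open>Consequences of the assumptions on the instance\<close>

locale admissible_instance =
  fixes I :: knapsack
  assumes admissible: "admissible I"
begin

lemma well_formed: "well_formed I"
  and density_bounded: "density_bounded I"
  and demand_bounded: "demand_bounded I"
  using admissible unfolding admissible_def by simp_all

lemma finite_resources [simp]: "finite (resources I)"
  and resources_nonempty: "resources I \<noteq> {}"
  using well_formed unfolding well_formed_def by simp_all

lemma finite_dims [simp]: "k \<in> resources I \<Longrightarrow> finite (dims I k)"
  and cap_pos: "k \<in> resources I \<Longrightarrow> m \<in> dims I k \<Longrightarrow> cap I k m > 0"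
  using well_formed unfolding well_formed_def by simp_all

lemma rho_min_pos: "k \<in> resources I \<Longrightarrow> rho_min I k > 0"
  and rho_min_le_max: "k \<in> resources I \<Longrightarrow> rho_min I k \<le> rho_max I k"
  using density_bounded unfolding density_bounded_def by simp_all

context
  fixes n k :: nat
  assumes nk: "n \<in> requests I" "k \<in> resources I"
begin

lemma reward_nonneg: "reward I n k \<ge> 0"
  and demand_nonneg: "m \<in> dims I k \<Longrightarrow> demand I n k m \<ge> 0"
  and ex_demand_pos: "\<exists>m\<in>dims I k. demand I n k m > 0"
  and slots_subset: "m \<in> dims I k \<Longrightarrow> slots I n k m \<subseteq> times I"
  and slots_interval: "m \<in> dims I k \<Longrightarrow> \<exists>a b. slots I n k m = {a..<b}"
proof -
  have *: "reward I n k \<ge> 0 \<and>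
      (\<forall>m\<in>dims I k. demand I n k m \<ge> 0) \<and>
      (\<exists>m\<in>dims I k. demand I n k m > 0) \<and>
      (\<forall>m\<in>dims I k. slots I n k m \<subseteq> times I \<and> (\<exists>a b. slots I n k m = {a..<b}))"
    using well_formed nk unfolding well_formed_def by blast
  then show "reward I n k \<ge> 0" "\<exists>m\<in>dims I k. demand I n k m > 0" by blast+
  show "demand I n k m \<ge> 0" "slots I n k m \<subseteq> times I" "\<exists>a b. slots I n k m = {a..<b}"
    if "m \<in> dims I k" for m
    using * that by blast+
qed

lemma finite_slots: "m \<in> dims I k \<Longrightarrow> finite (slots I n k m)"
  using finite_subset[OF slots_subset finite_times] .

lemma demand_le: "m \<in> dims I k \<Longrightarrow> demand I n k m \<le> cap I k m * ln 2 / gamma I k"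
  using admissible demand_bounded nk
  unfolding admissible_def demand_bounded_def by (meson order_trans)

text \<open>The denominator of \<open>xi\<close> is the smallest nonzero demand, hence at most the
  one in \<open>m\<close>. Thus a single dimension controls the total demand.\<close>

lemma sum_demand_le_xi_max:
  assumes "m \<in> dims I k" "demand I n k m > 0"
  shows "(\<Sum>m\<in>dims I k. demand I n k m) \<le> xi_max I k * demand I n k m"
proof -
  let ?D = "{demand I n k m | m. m \<in> dims I k \<and> demand I n k m \<noteq> 0}"
  have fin: "finite ?D" using nk by simp
  have mem: "demand I n k m \<in> ?D" using assms by auto
  then have "Min ?D \<in> ?D" using fin by (intro Min_in) auto
  then have pos: "Min ?D > 0" using demand_nonneg by force
  have le: "Min ?D \<le> demand I n k m" using fin mem by simp
  have nn: "0 \<le> (\<Sum>m\<in>dims I k. demand I n k m)" by (intro sum_nonneg demand_nonneg)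
  have "xi I n k \<le> xi_max I k"
    unfolding xi_max_def using nk by (intro Max_ge) auto
  moreover have "(\<Sum>m\<in>dims I k. demand I n k m) = xi I n k * Min ?D"
    using pos unfolding xi_def by simp
  moreover have "0 \<le> xi I n k" using nn pos unfolding xi_def by simp
  ultimately show ?thesis using le pos by (simp add: mult_mono)
qed

lemma xi_max_nonneg: "xi_max I k \<ge> 0"
proof -
  obtain m where m: "m \<in> dims I k" "demand I n k m > 0" using ex_demand_pos by blast
  have "0 \<le> (\<Sum>m\<in>dims I k. demand I n k m)" by (intro sum_nonneg demand_nonneg)
  then have "0 \<le> xi_max I k * demand I n k m" using sum_demand_le_xi_max[OF m] by linarith
  then show ?thesis using m by (simp add: zero_le_mult_iff)
qed

text \<open>The argument of the logarithm is \<open>2\<close> plus a nonnegative product. The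
  request \<open>n\<close> ensures that \<open>xi_max\<close> is a maximum over a nonempty
  set.\<close>

lemma gamma_ge: "gamma I k \<ge> 2 * ln 2"
proof -
  have "0 \<le> 4 * rho_bar I k * d_bar I k * xi_max I k"
    using xi_max_nonneg rho_min_pos[OF nk(2)] rho_min_le_max[OF nk(2)]
    by (simp add: rho_bar_def d_bar_def)
  then show ?thesis unfolding gamma_def by (intro mult_left_mono ln_mono) auto
qed

lemma gamma_pos: "gamma I k > 0"
  using gamma_ge ln_gt_zero[of "2::real"] by linarith

lemma dur_le_d_max: "m \<in> dims I k \<Longrightarrow> dur I n k m \<le> d_max I k"
  and d_min_le_dur: "m \<in> dims I k \<Longrightarrow> dur I n k m > 0 \<Longrightarrow> d_min I k \<le> dur I n k m"
  and d_min_pos: "m \<in> dims I k \<Longrightarrow> dur I n k m > 0 \<Longrightarrow> d_min I k > 0"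
proof -
  let ?A = "{dur I n k m | n m. n \<in> requests I \<and> m \<in> dims I k}"
  let ?B = "{dur I n k m | n m. n \<in> requests I \<and> m \<in> dims I k \<and> dur I n k m > 0}"
  have "?A = (\<lambda>(n, m). dur I n k m) ` (requests I \<times> dims I k)" by auto
  then have fA: "finite ?A" using nk by simp
  have fB: "finite ?B" by (rule finite_subset[OF _ fA]) auto
  show "dur I n k m \<le> d_max I k" if "m \<in> dims I k"
    unfolding d_max_def using fA nk that by (intro Max_ge) auto
  show "d_min I k \<le> dur I n k m" if "m \<in> dims I k" "dur I n k m > 0"
    unfolding d_min_def using fB nk that by (intro Min_le) auto
  show "d_min I k > 0" if "m \<in> dims I k" "dur I n k m > 0"
  proof -
    have "d_min I k \<in> ?B"
      unfolding d_min_def using fB nk that by (intro Min_in) auto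
    then show ?thesis by auto
  qed
qed

lemma reward_bounds:
  assumes "reward I n k > 0"
  shows "rho_min I k * (\<Sum>m\<in>dims I k. demand I n k m * real (dur I n k m)) \<le> reward I n k"
    and "reward I n k \<le> rho_max I k * (\<Sum>m\<in>dims I k. demand I n k m * real (dur I n k m))"
proof -
  let ?S = "\<Sum>m\<in>dims I k. demand I n k m * real (dur I n k m)"
  have *: "rho_min I k \<le> reward I n k / ?S" "reward I n k / ?S \<le> rho_max I k"
    using density_bounded nk assms unfolding density_bounded_def density_def by auto
  have "0 \<le> ?S" by (intro sum_nonneg mult_nonneg_nonneg demand_nonneg) auto
  \<comment> \<open>With a zero denominator the density would be \<open>0\<close> by the convention
    for division, which is below \<open>rho_min\<close>.\<close>
  moreover have "?S \<noteq> 0" using * rho_min_pos[OF nk(2)] by auto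
  ultimately have "?S > 0" by simp
  then show "rho_min I k * ?S \<le> reward I n k" "reward I n k \<le> rho_max I k * ?S"
    using * by (simp_all add: field_simps)
qed

text \<open>Durations are replaced by \<open>d_max\<close>, and the total demand by
  \<open>xi_max\<close> times the demand in \<open>m\<close>. The cost in dimension \<open>m\<close>
  is also proportional to that demand, which therefore cancels when cost and reward are
  compared.\<close>

lemma reward_le_demand:
  assumes "reward I n k > 0" "m \<in> dims I k" "demand I n k m > 0"
  shows "reward I n k \<le> rho_max I k * (real (d_max I k) * (xi_max I k * demand I n k m))"
proof -
  have "(\<Sum>m\<in>dims I k. demand I n k m * real (dur I n k m))
      \<le> (\<Sum>m\<in>dims I k. demand I n k m * real (d_max I k))"
    by (intro sum_mono mult_left_mono demand_nonneg) (auto dest: dur_le_d_max)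
  also have "\<dots> = real (d_max I k) * (\<Sum>m\<in>dims I k. demand I n k m)"
    by (simp add: sum_distrib_left mult.commute)
  also have "\<dots> \<le> real (d_max I k) * (xi_max I k * demand I n k m)"
    using sum_demand_le_xi_max assms by (intro mult_left_mono) auto
  finally show ?thesis
    using reward_bounds(2)[OF assms(1)] rho_min_pos[OF nk(2)] rho_min_le_max[OF nk(2)]
    by (smt (verit) mult_left_mono)
qed

lemma mu_ge_1: "m \<in> dims I k \<Longrightarrow> mu I n k m \<ge> 1"
  using demand_nonneg gamma_pos cap_pos[OF nk(2)] unfolding mu_def
  by (simp add: less_imp_le)

text \<open>The smallness of demands keeps the exponent of \<open>mu\<close> at most
  \<open>ln 2\<close>, where the linear bound on the exponential applies.\<close>

lemma cap_mult_mu_le: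
  assumes "m \<in> dims I k"
  shows "cap I k m * (mu I n k m - 1) \<le> 2 * gamma I k * demand I n k m"
proof -
  let ?y = "demand I n k m * gamma I k / cap I k m"
  have c: "cap I k m > 0" using cap_pos nk assms by blast
  have "?y \<le> ln 2"
    using demand_le[OF assms] gamma_pos c by (simp add: field_simps)
  moreover have "0 \<le> ?y" using demand_nonneg[OF assms] gamma_pos c by simp
  ultimately have "mu I n k m - 1 \<le> 2 * ?y"
    unfolding mu_def by (rule exp_minus_one_le_two_mult[rotated])
  then show ?thesis using c by (simp add: field_simps)
qed

end

section \<open>Loads and the effect of an assignment\<close>

lemma usage_nonneg:
  assumes "k \<in> resources I" "m \<in> dims I k" "\<And>n. x n k \<ge> 0"
  shows "usage I x k m S \<ge> 0"
  unfolding usage_def using assms demand_nonneg by (intro sum_nonneg) auto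

lemma usage_antimono:
  assumes "k \<in> resources I" "m \<in> dims I k" "\<And>n. x n k \<ge> 0" "S \<subseteq> S'"
  shows "usage I x k m S' \<le> usage I x k m S"
  unfolding usage_def using assms demand_nonneg by (intro sum_mono2) auto

lemma usage_assign:
  assumes "n \<in> requests I" "sol s n k = 0"
  shows "usage I (sol (assign I n k s)) k' m S =
    usage I (sol s) k' m S + (if k' = k \<and> S \<subseteq> slots I n k m then demand I n k m else 0)"
proof -
  let ?A = "{n. n \<in> requests I \<and> S \<subseteq> slots I n k' m}"
  have "usage I (sol (assign I n k s)) k' m S =
      (\<Sum>n'\<in>?A. demand I n' k' m * sol s n' k' + (if n' = n then (if k' = k then demand I n k m else 0) else 0))"
    unfolding usage_def using assms by (intro sum.cong) (auto simp: assign_def)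
  then show ?thesis
    using assms by (simp add: sum.distrib sum.delta usage_def)
qed

lemma total_value_assign:
  assumes "n \<in> requests I" "k \<in> resources I" "sol s n k = 0"
  shows "total_value I (sol (assign I n k s)) = total_value I (sol s) + reward I n k"
proof -
  have "total_value I (sol (assign I n k s)) = (\<Sum>n'\<in>requests I. \<Sum>k'\<in>resources I.
      reward I n' k' * sol s n' k' + (if k' = k then (if n' = n then reward I n k else 0) else 0))"
    unfolding total_value_def using assms by (intro sum.cong) (auto simp: assign_def)
  then show ?thesis
    using assms by (simp add: sum.distrib sum.delta total_value_def)
qed

section \<open>Invariants of a run\<close>

text \<open>Supplies the zero entry that makes an assignment a pure increment of loads and
  value.\<close>

lemma run_sol_future:
  assumes "alg_run I n s" "n \<le> n'"
  shows "sol s n' k = 0"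
  using assms by (induction arbitrary: n' rule: alg_run.induct) (auto simp: init_state_def assign_def)

lemma run_util_future:
  assumes "alg_run I n s" "n \<le> n'"
  shows "util s n' = 0"
  using assms by (induction arbitrary: n' rule: alg_run.induct) (auto simp: init_state_def assign_def)

text \<open>This form gives integrality, nonnegativity and the one-resource constraint at
  once.\<close>

lemma run_sol_row:
  assumes "alg_run I n s"
  shows "sol s n' = (\<lambda>k. 0) \<or> (\<exists>k\<in>resources I. sol s n' = (\<lambda>k'. if k' = k then 1 else 0))"
  using assms
proof (induction rule: alg_run.induct)
  case (accept n s k)
  have "k \<in> resources I" using accept by (simp add: is_arg_max_def)
  moreover have "sol s n = (\<lambda>k. 0)" using run_sol_future accept by blast
  ultimately have "sol (assign I n k s) n = (\<lambda>k'. if k' = k then 1 else 0)"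
    by (auto simp: assign_def)
  then show ?case
    using accept.IH \<open>k \<in> resources I\<close> by (cases "n' = n") (auto simp: assign_def)
qed (auto simp: init_state_def)

lemma run_sol_nonneg: "alg_run I n s \<Longrightarrow> sol s n' k \<ge> 0"
  using run_sol_row[of n s n'] by (auto split: if_splits)

text \<open>The update rule says that \<open>price + rho_min\<close> is multiplied by \<open>mu\<close>.\<close>

lemma run_price:
  assumes "alg_run I n s" "k \<in> resources I" "m \<in> dims I k"
  shows "price s k m t = rho_min I k * (exp (gamma I k * usage I (sol s) k m {t} / cap I k m) - 1)"
  using assms
proof (induction rule: alg_run.induct)
  case init
  then show ?case by (simp add: init_state_def usage_def)
next
  case (accept n s k0)
  have "sol s n k0 = 0" using run_sol_future accept by blast
  note u = usage_assign[OF accept.hyps(2) this]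
  have p: "price (assign I n k0 s) k m t = (if k = k0 \<and> t \<in> slots I n k m
      then mu I n k m * (price s k m t + rho_min I k) - rho_min I k else price s k m t)"
    using accept.prems(2) by (auto simp: assign_def beta_def algebra_simps)
  show ?case
    unfolding p u accept.IH[OF accept.prems]
    by (auto simp: mu_def exp_add add_divide_distrib algebra_simps)
qed

text \<open>Some request is assumed because the sign of \<open>gamma\<close> is derived from
  one.\<close>

lemma run_price_nonneg:
  assumes "alg_run I n s" "requests I \<noteq> {}" "k \<in> resources I" "m \<in> dims I k"
  shows "price s k m t \<ge> 0"
proof -
  obtain n' where "n' \<in> requests I" using assms by blast
  then have "gamma I k > 0" using gamma_pos assms by blast
  moreover have "usage I (sol s) k m {t} \<ge> 0"
    using usage_nonneg run_sol_nonneg assms by blast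
  ultimately show ?thesis
    using cap_pos[OF assms(3,4)] rho_min_pos[OF assms(3)] run_price[OF assms(1,3,4)] by simp
qed

lemma run_cost_nonneg:
  assumes "alg_run I n s" "n' \<in> requests I" "k \<in> resources I"
  shows "cost I s n' k \<ge> 0"
  unfolding cost_def using assms
  by (intro sum_nonneg mult_nonneg_nonneg demand_nonneg run_price_nonneg) auto

section \<open>Half windows and feasibility\<close>

text \<open>Every slot of \<open>S\<close> carries at least the load common to \<open>S\<close>, so
  \<open>S\<close> alone bounds the cost from below, while acceptance keeps the cost below the
  reward. The upper bound on the reward then limits the exponential of the load.\<close>

lemma usage_half_window_step:
  assumes run: "alg_run I n s" and n: "n \<in> requests I" and k: "k \<in> resources I"
    and m: "m \<in> dims I k" and acc: "reward I n k > cost I s n k"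
    and S: "S \<noteq> {}" "S \<subseteq> slots I n k m" "d_min I k \<le> 2 * card S"
    and w: "demand I n k m > 0"
  shows "usage I (sol s) k m S + demand I n k m \<le> cap I k m / 2"
proof -
  note c = cap_pos[OF k m] and g = gamma_pos[OF n k] and r = rho_min_pos[OF k]
  let ?w = "demand I n k m" and ?d = "real (d_min I k)" and ?L = "usage I (sol s) k m S"
  let ?E = "exp (gamma I k * ?L / cap I k m)"
  have fin: "finite (slots I n k m)" using finite_slots n k m by blast
  then have "card S > 0" using S by (meson card_gt_0_iff finite_subset)
  then have "dur I n k m > 0" unfolding dur_def using S fin by (meson card_mono less_le_trans)
  then have d: "?d > 0" using d_min_pos[OF n k m] by simp
  have L: "0 \<le> ?L" using usage_nonneg k m run_sol_nonneg[OF run] by blast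
  have E: "?E \<ge> 1" using L c g by simp
  have v: "reward I n k > 0" using acc run_cost_nonneg[OF run n k] by linarith
  \<comment> \<open>\<open>S\<close> has at least \<open>d_min / 2\<close> slots, each charged at
    least the price that load \<open>?L\<close> would give.\<close>
  have "?w * (?d / 2 * (rho_min I k * (?E - 1))) \<le> ?w * (real (card S) * (rho_min I k * (?E - 1)))"
    using S(3) E r w by (intro mult_left_mono mult_right_mono) auto
  also have "\<dots> = (\<Sum>t\<in>S. ?w * (rho_min I k * (?E - 1)))" by simp
  also have "\<dots> \<le> (\<Sum>t\<in>S. ?w * price s k m t)"
  proof (intro sum_mono mult_left_mono)
    fix t assume "t \<in> S"
    then have "?L \<le> usage I (sol s) k m {t}"
      using usage_antimono k m run_sol_nonneg[OF run] by blast
    then show "rho_min I k * (?E - 1) \<le> price s k m t"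
      unfolding run_price[OF run k m] using r g c
      by (intro mult_left_mono) (auto simp: divide_right_mono)
  qed (use w in auto)
  also have "\<dots> \<le> (\<Sum>t\<in>slots I n k m. ?w * price s k m t)"
    using fin S w run_price_nonneg[OF run _ k m] n
    by (intro sum_mono2 mult_nonneg_nonneg) auto
  also have "\<dots> \<le> cost I s n k"
    unfolding cost_def
    using k m n by (intro member_le_sum sum_nonneg mult_nonneg_nonneg demand_nonneg
        run_price_nonneg[OF run]) auto
  also have "\<dots> < reward I n k" by (rule acc)
  also have "\<dots> \<le> ?w * (rho_max I k * real (d_max I k) * xi_max I k)"
    using reward_le_demand[OF n k v m w] by (simp add: mult_ac)
  finally have "?d / 2 * (rho_min I k * (?E - 1)) < rho_max I k * real (d_max I k) * xi_max I k"
    using w by (simp only: mult_less_cancel_left_pos)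
  then have "?E - 1 < 2 * rho_bar I k * d_bar I k * xi_max I k"
    using d r by (simp add: rho_bar_def d_bar_def field_simps)
  \<comment> \<open>Doubling produces the argument of the logarithm in \<open>gamma\<close>, that
    is, \<open>exp (gamma I k / 2)\<close>.\<close>
  then have E2: "2 * ?E < 4 * rho_bar I k * d_bar I k * xi_max I k + 2" by simp
  have "ln 2 + gamma I k * ?L / cap I k m = ln (2 * ?E)" by (simp add: ln_mult)
  also have "\<dots> < ln (4 * rho_bar I k * d_bar I k * xi_max I k + 2)"
    using E2 by (intro ln_less_cancel_iff[THEN iffD2]) (auto intro: less_trans[OF _ E2])
  also have "\<dots> = gamma I k / 2" by (simp add: gamma_def)
  \<comment> \<open>The factor \<open>2\<close> in front of \<open>?E\<close> has become a slack
    equal to the bound on a single demand.\<close>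
  finally have "cap I k m * ln 2 / gamma I k + ?L < cap I k m / 2"
    using g c by (simp add: field_simps)
  then show ?thesis using demand_le[OF n k m] by linarith
qed

lemma run_usage_half_window:
  assumes "alg_run I n s" "k \<in> resources I" "m \<in> dims I k"
    "S \<noteq> {}" "d_min I k \<le> 2 * card S"
  shows "usage I (sol s) k m S \<le> cap I k m / 2"
  using assms
proof (induction rule: alg_run.induct)
  case init
  then show ?case using cap_pos by (simp add: init_state_def usage_def less_imp_le)
next
  case (accept n s k0)
  have z: "sol s n k0 = 0" using run_sol_future accept by blast
  show ?case
  proof (cases "k = k0 \<and> S \<subseteq> slots I n k m \<and> demand I n k m > 0")
    case True
    then have "usage I (sol s) k m S + demand I n k m \<le> cap I k m / 2"
      using accept by (intro usage_half_window_step[of n s k m S]) auto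
    then show ?thesis using True by (auto simp: usage_assign[OF accept.hyps(2) z])
  next
    case False
    \<comment> \<open>The step lemma requires a positive demand; a zero demand leaves the load
      unchanged.\<close>
    then have "k = k0 \<and> S \<subseteq> slots I n k m \<longrightarrow> demand I n k m = 0"
      using demand_nonneg accept.hyps(2) accept.prems(1,2) by force
    then show ?thesis
      using accept.IH accept.prems by (auto simp: usage_assign[OF accept.hyps(2) z])
  qed
qed

lemma run_capacity:
  assumes run: "alg_run I n s" and k: "k \<in> resources I" and m: "m \<in> dims I k"
  shows "usage I (sol s) k m {t} \<le> cap I k m"
proof (cases "\<exists>n\<in>requests I. t \<in> slots I n k m")
  case False
  then have "usage I (sol s) k m {t} = 0"
    unfolding usage_def by (intro sum.neutral) auto
  then show ?thesis using cap_pos[OF k m] by simp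
next
  case True
  have dur_pos: "dur I n k m > 0" if "n \<in> requests I" "t \<in> slots I n k m" for n
    using that finite_slots[OF that(1) k m] unfolding dur_def by (auto simp: card_gt_0_iff)
  with True have d: "d_min I k > 0" using d_min_pos[OF _ k m] by blast
  \<comment> \<open>Rounding up gives \<open>d_min \<le> 2 * h\<close>, so half windows are long
    enough for the price argument, while \<open>2 * h - 1 \<le> d_min\<close> makes every interval
    through \<open>t\<close> contain one.\<close>
  define h where "h = (d_min I k + 1) div 2"
  define A where "A = {n. n \<in> requests I \<and> h \<le> t + 1 \<and> {t + 1 - h..t} \<subseteq> slots I n k m}"
  define B where "B = {n. n \<in> requests I \<and> {t..<t + h} \<subseteq> slots I n k m}"
  let ?f = "\<lambda>n. demand I n k m * sol s n k"
  have h: "h > 0" "d_min I k \<le> 2 * h" using d unfolding h_def by auto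
  have f: "?f n \<ge> 0" if "n \<in> requests I" for n
    using demand_nonneg[OF that k m] run_sol_nonneg[OF run] by simp
  have sub: "{n. n \<in> requests I \<and> {t} \<subseteq> slots I n k m} \<subseteq> A \<union> B"
  proof
    fix n assume "n \<in> {n. n \<in> requests I \<and> {t} \<subseteq> slots I n k m}"
    then have n: "n \<in> requests I" and t: "t \<in> slots I n k m" by auto
    obtain a b where ab: "slots I n k m = {a..<b}" using slots_interval[OF n k m] by blast
    have "d_min I k \<le> card {a..<b}"
      using d_min_le_dur[OF n k m dur_pos[OF n t]] ab unfolding dur_def by simp
    from interval_half_window[OF _ this h_def d] t show "n \<in> A \<union> B"
      using n ab unfolding A_def B_def by auto
  qed
  have fin: "finite A" "finite B" unfolding A_def B_def by auto
  have "usage I (sol s) k m {t} \<le> sum ?f (A \<union> B)"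
    unfolding usage_def using sub fin f by (intro sum_mono2) (auto simp: A_def B_def)
  \<comment> \<open>\<open>A\<close> and \<open>B\<close> may overlap; the overlap contributes a
    nonnegative sum.\<close>
  also have "\<dots> \<le> sum ?f A + sum ?f B"
    using fin f by (simp add: sum_Un) (auto intro!: sum_nonneg simp: A_def)
  also have "sum ?f A \<le> cap I k m / 2"
  proof (cases "h \<le> t + 1")
    case True
    then have "sum ?f A = usage I (sol s) k m {t + 1 - h..t}"
      unfolding A_def usage_def by simp
    also have "\<dots> \<le> cap I k m / 2"
      using True h by (intro run_usage_half_window[OF run k m]) auto
    finally show ?thesis .
  next
    \<comment> \<open>Near slot \<open>0\<close> no full left window fits, and \<open>A\<close> is
      empty.\<close>
    case False
    then show ?thesis unfolding A_def using cap_pos[OF k m] by simp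
  qed
  also have "sum ?f B = usage I (sol s) k m {t..<t + h}"
    unfolding B_def usage_def by simp
  also have "\<dots> \<le> cap I k m / 2"
    using h by (intro run_usage_half_window[OF run k m]) auto
  finally show ?thesis by simp
qed

lemma run_feasible:
  assumes "alg_run I n s"
  shows "feasible I (sol s)"
  unfolding feasible_def
proof (intro conjI ballI)
  fix n' k
  show "sol s n' k \<in> {0, 1}" using run_sol_row[OF assms, of n'] by auto
next
  fix n'
  show "(\<Sum>k\<in>resources I. sol s n' k) \<le> 1" using run_sol_row[OF assms, of n'] by auto
next
  fix k m t assume "k \<in> resources I" "m \<in> dims I k"
  then show "(\<Sum>n | n \<in> requests I \<and> t \<in> slots I n k m. demand I n k m * sol s n k) \<le> cap I k m"
    using run_capacity[OF assms, of k m t] by (simp add: usage_def)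
qed

section \<open>Existence of a run\<close>

lemma ex_best_resource:
  fixes f :: "nat \<Rightarrow> real"
  shows "\<exists>k. is_arg_max f (\<lambda>k. k \<in> resources I) k"
proof -
  have "Max (f ` resources I) \<in> f ` resources I"
    using resources_nonempty by (intro Max_in) auto
  then obtain k where "k \<in> resources I" "f k = Max (f ` resources I)" by auto
  then have "is_arg_max f (\<lambda>k. k \<in> resources I) k"
    by (simp add: is_arg_max_linorder)
  then show ?thesis ..
qed

text \<open>Shows that statements about all outputs of the algorithm are not vacuous.\<close>

lemma ex_run: "n \<le> num_requests I \<Longrightarrow> \<exists>s. alg_run I n s"
proof (induction n)
  case 0
  then show ?case using alg_run.init by blast
next
  case (Suc n)
  then obtain s where s: "alg_run I n s" by auto
  have "n \<in> requests I" using Suc by (simp add: requests_def)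
  moreover obtain k where
    "is_arg_max (\<lambda>k. reward I n k - cost I s n k) (\<lambda>k. k \<in> resources I) k"
    using ex_best_resource by blast
  ultimately show ?case using s alg_run.accept alg_run.reject by blast
qed

section \<open>Monotone prices and dual feasibility\<close>

lemma price_assign_mono:
  assumes "alg_run I n s" "n \<in> requests I" "k \<in> resources I" "k' \<in> resources I" "m \<in> dims I k'"
  shows "price s k' m t \<le> price (assign I n k s) k' m t"
proof (cases "k' = k \<and> t \<in> slots I n k m")
  case True
  then have *: "m \<in> dims I k" using assms by simp
  have mu: "mu I n k m \<ge> 1" using mu_ge_1 assms * by blast
  have "price s k m t \<ge> 0" using run_price_nonneg assms * by blast
  then have "price s k m t \<le> mu I n k m * price s k m t"
    using mult_right_mono[OF mu] by simp
  moreover have "beta I n k m \<ge> 0"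
    using mu rho_min_pos[OF assms(3)] by (simp add: beta_def)
  ultimately show ?thesis using True * by (simp add: assign_def)
qed (auto simp: assign_def)

lemma cost_assign_mono:
  assumes "alg_run I n s" "n \<in> requests I" "k \<in> resources I" "k' \<in> resources I"
    "n' \<in> requests I"
  shows "cost I s n' k' \<le> cost I (assign I n k s) n' k'"
  unfolding cost_def using assms
  by (intro sum_mono mult_left_mono price_assign_mono demand_nonneg) auto

lemma run_util_nonneg: "alg_run I n s \<Longrightarrow> util s n' \<ge> 0"
  by (induction rule: alg_run.induct) (auto simp: init_state_def assign_def)

text \<open>On arrival \<open>util\<close> becomes the best surplus over all resources, or stays
  \<open>0\<close> if that surplus is not positive. Later price increases only weaken the
  constraint.\<close>

lemma run_dual_feasible:
  assumes "alg_run I n s" "n' < n" "k \<in> resources I"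
  shows "reward I n' k - cost I s n' k \<le> util s n'"
  using assms
proof (induction rule: alg_run.induct)
  case (accept n s k0)
  have k0: "k0 \<in> resources I" using accept by (simp add: is_arg_max_def)
  have n': "n' \<in> requests I" using accept by (auto simp: requests_def)
  have mono: "cost I s n' k \<le> cost I (assign I n k0 s) n' k"
    using cost_assign_mono accept k0 n' by blast
  show ?case
  proof (cases "n' = n")
    case True
    have "reward I n k - cost I s n k \<le> reward I n k0 - cost I s n k0"
      using accept by (auto simp: is_arg_max_linorder)
    then show ?thesis using mono True by (simp add: assign_def)
  next
    case False
    then have "reward I n' k - cost I s n' k \<le> util s n'" using accept by auto
    then show ?thesis using mono False by (simp add: assign_def)
  qed
next
  case (reject n s k0)
  show ?case
  proof (cases "n' = n")
    case True
    have "reward I n k - cost I s n k \<le> reward I n k0 - cost I s n k0"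
      using reject by (auto simp: is_arg_max_linorder)
    then show ?thesis
      using True reject.hyps(4) run_util_nonneg[OF reject.hyps(1), of n'] by simp
  next
    case False
    then show ?thesis using reject by auto
  qed
qed auto

section \<open>Growth of the dual objective\<close>

text \<open>The utilities gain reward minus cost. The priced capacity gains at most
  \<open>2 * gamma\<close> times the sum of the cost and \<open>rho_min\<close> times the total
  resource consumption, each at most the reward.\<close>

lemma dual_value_assign_le:
  assumes run: "alg_run I n s" and n: "n \<in> requests I" and k: "k \<in> resources I"
    and acc: "reward I n k > cost I s n k"
  shows "dual_value I (assign I n k s) \<le> dual_value I s + (1 + 4 * gamma I k) * reward I n k"
proof -
  let ?s' = "assign I n k s"
  let ?c = "cost I s n k" and ?v = "reward I n k" and ?g = "gamma I k"
  let ?W = "\<Sum>m\<in>dims I k. demand I n k m * real (dur I n k m)"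
  \<comment> \<open>Since the update multiplies \<open>price + rho_min\<close> by \<open>mu\<close>,
    this is the exact change of the priced capacity in one slot.\<close>
  let ?inc = "\<lambda>m t. cap I k m * ((mu I n k m - 1) * (price s k m t + rho_min I k))"
  have v: "?v > 0" using acc run_cost_nonneg[OF run n k] by linarith
  have "util s n = 0" using run_util_future run by blast
  then have "util ?s' n' = util s n' + (if n' = n then ?v - ?c else 0)" for n'
    by (simp add: assign_def)
  then have u: "(\<Sum>n'\<in>requests I. util ?s' n') = (\<Sum>n'\<in>requests I. util s n') + (?v - ?c)"
    using n by (simp add: sum.distrib sum.delta)
  have p: "(\<Sum>t\<in>times I. cap I k' m * price ?s' k' m t) =
      (\<Sum>t\<in>times I. cap I k' m * price s k' m t) +
      (if k' = k then \<Sum>t\<in>slots I n k m. ?inc m t else 0)" if "m \<in> dims I k'" for k' m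
  proof (cases "k' = k")
    case True
    then have m: "m \<in> dims I k" using that by simp
    have "(\<Sum>t\<in>times I. cap I k m * price ?s' k m t) =
        (\<Sum>t\<in>times I. cap I k m * price s k m t + (if t \<in> slots I n k m then ?inc m t else 0))"
      using m by (intro sum.cong) (auto simp: assign_def beta_def algebra_simps)
    also have "\<dots> = (\<Sum>t\<in>times I. cap I k m * price s k m t)
        + (\<Sum>t\<in>times I \<inter> slots I n k m. ?inc m t)"
      by (simp add: sum.distrib sum.inter_restrict)
    also have "times I \<inter> slots I n k m = slots I n k m" using slots_subset[OF n k m] by blast
    finally show ?thesis using True by simp
  qed (simp add: assign_def)
  have "(\<Sum>k'\<in>resources I. \<Sum>m\<in>dims I k'. \<Sum>t\<in>times I. cap I k' m * price ?s' k' m t) =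
      (\<Sum>k'\<in>resources I. (\<Sum>m\<in>dims I k'. \<Sum>t\<in>times I. cap I k' m * price s k' m t)
        + (if k' = k then \<Sum>m\<in>dims I k. \<Sum>t\<in>slots I n k m. ?inc m t else 0))"
    by (intro sum.cong) (auto simp: p sum.distrib)
  also have "\<dots> = (\<Sum>k'\<in>resources I. \<Sum>m\<in>dims I k'. \<Sum>t\<in>times I. cap I k' m * price s k' m t)
      + (\<Sum>m\<in>dims I k. \<Sum>t\<in>slots I n k m. ?inc m t)"
    using k by (simp add: sum.distrib sum.delta)
  finally have dual: "dual_value I ?s' = dual_value I s + (?v - ?c)
      + (\<Sum>m\<in>dims I k. \<Sum>t\<in>slots I n k m. ?inc m t)"
    using u by (simp add: dual_value_def)
  have "(\<Sum>m\<in>dims I k. \<Sum>t\<in>slots I n k m. ?inc m t)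
      \<le> (\<Sum>m\<in>dims I k. \<Sum>t\<in>slots I n k m.
           2 * ?g * demand I n k m * (price s k m t + rho_min I k))"
  proof (intro sum_mono)
    fix m t assume m: "m \<in> dims I k"
    have "price s k m t \<ge> 0" using run_price_nonneg run n k m by blast
    then show "?inc m t \<le> 2 * ?g * demand I n k m * (price s k m t + rho_min I k)"
      using mult_right_mono[OF cap_mult_mu_le[OF n k m]] rho_min_pos[OF k]
      by (simp add: mult.assoc)
  qed
  also have "\<dots> = (\<Sum>m\<in>dims I k. 2 * ?g * ((\<Sum>t\<in>slots I n k m. demand I n k m * price s k m t)
      + rho_min I k * (demand I n k m * real (dur I n k m))))"
  proof (rule sum.cong[OF refl])
    fix m
    have "(\<Sum>t\<in>slots I n k m. 2 * ?g * demand I n k m * (price s k m t + rho_min I k)) =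
        (\<Sum>t\<in>slots I n k m. 2 * ?g * (demand I n k m * price s k m t + demand I n k m * rho_min I k))"
      by (simp add: distrib_left mult.assoc)
    also have "\<dots> = 2 * ?g * ((\<Sum>t\<in>slots I n k m. demand I n k m * price s k m t)
        + real (dur I n k m) * (demand I n k m * rho_min I k))"
      unfolding sum_distrib_left[symmetric] sum.distrib dur_def by simp
    finally show "(\<Sum>t\<in>slots I n k m. 2 * ?g * demand I n k m * (price s k m t + rho_min I k)) =
        2 * ?g * ((\<Sum>t\<in>slots I n k m. demand I n k m * price s k m t)
        + rho_min I k * (demand I n k m * real (dur I n k m)))"
      by (simp only: mult_ac)
  qed
  also have "\<dots> = 2 * ?g * (?c + rho_min I k * ?W)"
    unfolding cost_def sum_distrib_left[symmetric] sum.distrib ..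
  \<comment> \<open>The cost is below the reward by acceptance, the other term is bounded by it
    through the lower density bound.\<close>
  also have "\<dots> \<le> 2 * ?g * (?v + ?v)"
    using acc reward_bounds(1)[OF n k v] gamma_pos[OF n k] by (intro mult_left_mono) auto
  finally show ?thesis
    using run_cost_nonneg[OF run n k] unfolding dual by (simp add: distrib_right)
qed

text \<open>Both sides start at \<open>0\<close>, and each acceptance is charged to its own reward
  at a rate \<open>a\<close> uniform in the resource.\<close>

lemma run_dual_value_le:
  assumes "alg_run I n s" "\<And>k. k \<in> resources I \<Longrightarrow> 1 + 4 * gamma I k \<le> a"
  shows "dual_value I s \<le> a * total_value I (sol s)"
  using assms
proof (induction rule: alg_run.induct)
  case init
  then show ?case by (simp add: dual_value_def total_value_def init_state_def)
next
  case (accept n s k)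
  have k: "k \<in> resources I" using accept by (simp add: is_arg_max_def)
  have z: "sol s n k = 0" using run_sol_future accept by blast
  have "dual_value I (assign I n k s) \<le> dual_value I s + (1 + 4 * gamma I k) * reward I n k"
    using dual_value_assign_le accept k by blast
  also have "\<dots> \<le> a * total_value I (sol s) + a * reward I n k"
    using accept k reward_nonneg[OF accept.hyps(2) k] by (intro add_mono mult_right_mono) auto
  finally show ?case
    by (simp add: total_value_assign[OF accept.hyps(2) k z] algebra_simps)
next
  case reject
  show ?case by (rule reject.IH) (rule reject.prems)
qed

section \<open>Weak duality and the competitive ratio\<close>

text \<open>Rewards are bounded through the dual constraints, then the row sums of \<open>x\<close>
  by \<open>1\<close> and its loads by the capacities.\<close>

lemma weak_duality:
  assumes run: "alg_run I (num_requests I) s" and x: "feasible I x" and ne: "requests I \<noteq> {}"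
  shows "total_value I x \<le> dual_value I s"
proof -
  have x0: "x n k \<ge> 0" if "n \<in> requests I" "k \<in> resources I" for n k
    using x that unfolding feasible_def by force
  have "total_value I x \<le> (\<Sum>n\<in>requests I. \<Sum>k\<in>resources I. (util s n + cost I s n k) * x n k)"
    unfolding total_value_def
  proof (intro sum_mono mult_right_mono x0)
    fix n k assume "n \<in> requests I" "k \<in> resources I"
    then show "reward I n k \<le> util s n + cost I s n k"
      using run_dual_feasible[OF run, of n k] by (simp add: requests_def)
  qed
  also have "\<dots> = (\<Sum>n\<in>requests I. util s n * (\<Sum>k\<in>resources I. x n k))
      + (\<Sum>n\<in>requests I. \<Sum>k\<in>resources I. cost I s n k * x n k)"
    by (simp add: distrib_right sum.distrib sum_distrib_left)
  also have "(\<Sum>n\<in>requests I. util s n * (\<Sum>k\<in>resources I. x n k)) \<le> (\<Sum>n\<in>requests I. util s n)"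
    using x run_util_nonneg[OF run] unfolding feasible_def
    by (intro sum_mono mult_left_le) auto
  also have "(\<Sum>n\<in>requests I. \<Sum>k\<in>resources I. cost I s n k * x n k) =
      (\<Sum>k\<in>resources I. \<Sum>n\<in>requests I. cost I s n k * x n k)"
    by (rule sum.swap)
  also have "\<dots> \<le> (\<Sum>k\<in>resources I. \<Sum>m\<in>dims I k. \<Sum>t\<in>times I. cap I k m * price s k m t)"
  proof (rule sum_mono)
    fix k assume k: "k \<in> resources I"
    \<comment> \<open>Summing over all of \<open>times I\<close> with a case distinction makes the
      index set independent of \<open>n\<close>, so that the sums can be interchanged.\<close>
    have "(\<Sum>n\<in>requests I. cost I s n k * x n k) = (\<Sum>n\<in>requests I. \<Sum>m\<in>dims I k. \<Sum>t\<in>times I.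
        if t \<in> slots I n k m then demand I n k m * x n k * price s k m t else 0)"
    proof (rule sum.cong)
      fix n assume n: "n \<in> requests I"
      have "cost I s n k * x n k = (\<Sum>m\<in>dims I k. \<Sum>t\<in>times I \<inter> slots I n k m.
          demand I n k m * x n k * price s k m t)"
        unfolding cost_def sum_distrib_right
        by (intro sum.cong) (use slots_subset[OF n k] in \<open>auto simp: mult_ac\<close>)
      then show "cost I s n k * x n k = (\<Sum>m\<in>dims I k. \<Sum>t\<in>times I.
          if t \<in> slots I n k m then demand I n k m * x n k * price s k m t else 0)"
        by (simp add: sum.inter_restrict)
    qed simp
    also have "\<dots> = (\<Sum>m\<in>dims I k. \<Sum>n\<in>requests I. \<Sum>t\<in>times I.
        if t \<in> slots I n k m then demand I n k m * x n k * price s k m t else 0)"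
      by (rule sum.swap)
    also have "\<dots> = (\<Sum>m\<in>dims I k. \<Sum>t\<in>times I. \<Sum>n\<in>requests I.
        if t \<in> slots I n k m then demand I n k m * x n k * price s k m t else 0)"
      by (intro sum.cong[OF refl] sum.swap)
    also have "\<dots> = (\<Sum>m\<in>dims I k. \<Sum>t\<in>times I.
        (\<Sum>n | n \<in> requests I \<and> t \<in> slots I n k m. demand I n k m * x n k) * price s k m t)"
      unfolding sum_distrib_right by (intro sum.cong[OF refl] sum.inter_filter[symmetric]) simp
    also have "\<dots> \<le> (\<Sum>m\<in>dims I k. \<Sum>t\<in>times I. cap I k m * price s k m t)"
      using x k run_price_nonneg[OF run ne k] unfolding feasible_def
      by (intro sum_mono mult_right_mono) auto
    finally show "(\<Sum>n\<in>requests I. cost I s n k * x n k)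
        \<le> (\<Sum>m\<in>dims I k. \<Sum>t\<in>times I. cap I k m * price s k m t)" .
  qed
  finally show ?thesis by (simp add: dual_value_def)
qed

text \<open>The supremum is taken over a nonempty set because the zero solution is feasible.\<close>

lemma offline_opt_le:
  assumes "\<And>x. feasible I x \<Longrightarrow> total_value I x \<le> b"
  shows "offline_opt I \<le> b"
proof -
  have "feasible I (\<lambda>n k. 0)"
    using cap_pos by (auto simp: feasible_def less_imp_le)
  then show ?thesis unfolding offline_opt_def using assms by (intro cSUP_least) auto
qed

text \<open>Passes from the parameters of one resource to the product of separate maxima, the
  argument of the final ratio; nonnegative factors make the product monotone.\<close>

lemma gamma_le:
  assumes n: "n \<in> requests I" and k: "k \<in> resources I"
  shows "gamma I k \<le> 2 * ln (4 * ((MAX k\<in>resources I. rho_bar I k) *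
    (MAX k\<in>resources I. xi_max I k) * (MAX k\<in>resources I. d_bar I k)) + 2)"
proof -
  have nn: "rho_bar I k \<ge> 0" "xi_max I k \<ge> 0" "d_bar I k \<ge> 0"
    using xi_max_nonneg[OF n k] rho_min_pos[OF k] rho_min_le_max[OF k]
    by (auto simp: rho_bar_def d_bar_def)
  have le: "f k \<le> (MAX k\<in>resources I. f k)" for f :: "nat \<Rightarrow> real"
    using k by (intro Max_ge) auto
  have "rho_bar I k * xi_max I k * d_bar I k \<le> (MAX k\<in>resources I. rho_bar I k) *
    (MAX k\<in>resources I. xi_max I k) * (MAX k\<in>resources I. d_bar I k)"
    using nn le[of "rho_bar I"] le[of "xi_max I"] le[of "d_bar I"]
    by (intro mult_mono mult_nonneg_nonneg) (auto intro: order_trans)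
  moreover have "rho_bar I k * xi_max I k * d_bar I k \<ge> 0" using nn by simp
  ultimately show ?thesis
    unfolding gamma_def by (simp add: mult_ac)
qed

lemma competitive:
  assumes run: "alg_run I (num_requests I) s"
  shows "offline_opt I \<le> (1 + 8 * ln (4 * ((MAX k\<in>resources I. rho_bar I k) *
    (MAX k\<in>resources I. xi_max I k) * (MAX k\<in>resources I. d_bar I k)) + 2))
    * total_value I (sol s)"
proof (cases "requests I = {}")
  \<comment> \<open>Without requests every solution has value \<open>0\<close>, whatever the ratio
    evaluates to.\<close>
  case True
  then show ?thesis by (intro offline_opt_le) (simp add: total_value_def)
next
  case False
  then obtain n where n: "n \<in> requests I" by blast
  show ?thesis
  proof (rule offline_opt_le)
    fix x assume "feasible I x"
    then have "total_value I x \<le> dual_value I s" using weak_duality run False by blast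
    also have "\<dots> \<le> (1 + 8 * ln (4 * ((MAX k\<in>resources I. rho_bar I k) *
        (MAX k\<in>resources I. xi_max I k) * (MAX k\<in>resources I. d_bar I k)) + 2))
        * total_value I (sol s)"
      \<comment> \<open>The bound \<open>gamma \<le> 2 * ln (...)\<close> turns
        \<open>1 + 4 * gamma\<close> into \<open>1 + 8 * ln (...)\<close>.\<close>
      using gamma_le[OF n] by (intro run_dual_value_le[OF run]) fastforce
    finally show "total_value I x \<le> \<dots>" .
  qed
qed

end

theorem theorem3:
  shows "(\<forall>I. admissible I \<longrightarrow>
            (\<exists>x. alg_output I x) \<and> (\<forall>x. alg_output I x \<longrightarrow> feasible I x)) \<and>
         (\<exists>\<alpha> :: real \<Rightarrow> real. \<alpha> \<in> O(\<lambda>z. ln z) \<and>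
            (\<forall>I x. admissible I \<and> alg_output I x \<longrightarrow>
               offline_opt I
                 \<le> \<alpha> ((MAX k\<in>resources I. rho_bar I k) * (MAX k\<in>resources I. xi_max I k)
                        * (MAX k\<in>resources I. d_bar I k))
                   * total_value I x))"
\<comment> \<open>The witness is the ratio just proved, as a function of the product
  \<open>z\<close> of the maxima. The growth claim concerns \<open>z\<close> tending to infinity,
  where the constants are absorbed.\<close>
proof (intro conjI exI[of _ "\<lambda>z. 1 + 8 * ln (4 * z + 2)"] allI impI)
  fix I assume "admissible I"
  then interpret admissible_instance I by unfold_locales
  show "\<exists>x. alg_output I x" using ex_run unfolding alg_output_def by blast
  show "feasible I x" if "alg_output I x" for x
    using that run_feasible unfolding alg_output_def by blast
next
  show "(\<lambda>z::real. 1 + 8 * ln (4 * z + 2)) \<in> O(\<lambda>z. ln z)" by real_asymp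
next
  fix I x assume *: "admissible I \<and> alg_output I x"
  then interpret admissible_instance I by unfold_locales simp
  show "offline_opt I \<le> (1 + 8 * ln (4 * ((MAX k\<in>resources I. rho_bar I k) *
      (MAX k\<in>resources I. xi_max I k) * (MAX k\<in>resources I. d_bar I k)) + 2)) * total_value I x"
    using * competitive unfolding alg_output_def by blast
qed

end
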